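(* Every nonempty bounded above subset of $(\mathcal R,\preceq)$ has a least upper bound in $\mathcal R$, and every nonempty bounded below subset of $(\mathcal R,\preceq)$ has a greatest lower bound in $\mathcal R$.
   Context: $\mathbb N=\{1,2,3,\dots\}$ and $\mathcal Z_{10}=\{0,1,\dots,9\}$. $\mathcal R$ is the set of all formal decimals $x=x_0.x_1x_2x_3\cdots$ with $x_0\in\mathbb Z$ and $x_k\in\mathcal Z_{10}$ for $k\in\mathbb N$; two elements are equal iff all their digits agree (so $0.999\cdots\neq 1.000\cdots$ in $\mathcal R$). For $k\in\mathbb N$, $[x]_k=\sum_{i=0}^k x_i10^{-i}\in\mathbb Q$ is the truncation of $x$ up to the $k$-th digit. The (lexicographical) order on $\mathcal R$ is: $x\preceq y$ iff $[x]_k\le [y]_k$ for all $k\in\mathbb N$. A nonempty subset $W\subset\mathcal R$ is bounded above (below) if there is $M\in\mathcal R$ with $w\preceq M$ (respectively $M\preceq w$) for all $w\in W$. *)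

theory Defs
  imports Complex_Main "HOL-Library.Lub_Glb"
begin

text \<open>
  Formal decimals \<open>x\<^sub>0.x\<^sub>1x\<^sub>2x\<^sub>3\<dots>\<close>: \<open>digit x 0\<close> is an arbitrary integer, all later digits
  lie between 0 and 9. Equality is equality of all digits, so \<open>0.999\<dots>\<close> and \<open>1.000\<dots>\<close> differ.
\<close>

typedef decimal = "{x :: nat \<Rightarrow> int. \<forall>k\<ge>1. x k \<in> {0..9}}"
  morphisms digit Decimal
  by (rule exI[of _ "\<lambda>_. 0"]) simp

definition trunc :: "decimal \<Rightarrow> nat \<Rightarrow> rat" where
  "trunc x k = (\<Sum>i=0..k. of_int (digit x i) / 10 ^ i)"

lemma digit_bounds:
  assumes "k \<ge> 1"
  shows "0 \<le> digit x k" "digit x k \<le> 9"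
  using digit[of x] assms by auto

lemma trunc_Suc: "trunc x (Suc k) = trunc x k + of_int (digit x (Suc k)) / 10 ^ Suc k"
  by (simp add: trunc_def)

lemma trunc_eqD:
  assumes "\<forall>k\<ge>1. trunc x k = trunc y k"
  shows "x = y"
proof -
  have "trunc x 1 = trunc y 1"
    using assms by simp
  then have "of_int (10 * digit x 0 + digit x 1) = (of_int (10 * digit y 0 + digit y 1) :: rat)"
    by (simp add: trunc_def field_simps)
  then have "10 * digit x 0 + digit x 1 = 10 * digit y 0 + digit y 1"
    by (simp only: of_int_eq_iff)
  then have "digit x 0 = digit y 0"
    using digit_bounds[of 1 x] digit_bounds[of 1 y] by simp
  then have trunc_eq: "trunc x k = trunc y k" for k
    using assms by (cases k) (auto simp: trunc_def)
  have "digit x k = digit y k" for k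
  proof (cases k)
    case 0
    then show ?thesis using \<open>digit x 0 = digit y 0\<close> by simp
  next
    case (Suc j)
    then show ?thesis
      using trunc_eq[of "Suc j"] trunc_eq[of j] by (simp add: trunc_Suc)
  qed
  then show ?thesis
    by (simp add: digit_inject[symmetric] fun_eq_iff)
qed

instantiation decimal :: order
begin

definition less_eq_decimal :: "decimal \<Rightarrow> decimal \<Rightarrow> bool" where
  "x \<le> y \<longleftrightarrow> (\<forall>k\<ge>1. trunc x k \<le> trunc y k)"

definition less_decimal :: "decimal \<Rightarrow> decimal \<Rightarrow> bool" where
  "x < y \<longleftrightarrow> x \<le> y \<and> \<not> y \<le> x" for x y :: decimal

instance
proof
  fix x y z :: decimal
  show "x < y \<longleftrightarrow> x \<le> y \<and> \<not> y \<le> x"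
    by (rule less_decimal_def)
  show "x \<le> x"
    by (simp add: less_eq_decimal_def)
  show "x \<le> z" if "x \<le> y" "y \<le> z"
    using that unfolding less_eq_decimal_def by (meson order_trans)
  show "x = y" if "x \<le> y" "y \<le> x"
    using that unfolding less_eq_decimal_def by (intro trunc_eqD) (simp add: order_antisym)
qed

end

end

theory Submission
  imports Defs
begin

text \<open>
  Read the truncation at place \<open>k\<close> as the integer obtained by moving the decimal point \<open>k\<close> places.
  Decimals then correspond to integer sequences \<open>F\<close> with \<open>F k = F (k + 1) div 10\<close>, ordered
  pointwise. Division by 10 is monotone and a nonempty set of integers that is bounded above has a
  largest element, so pointwise suprema again satisfy this condition. Greatest lower bounds are
  least upper bounds of sets of lower bounds.
\<close>

definition scaled_trunc :: "decimal \<Rightarrow> nat \<Rightarrow> int" where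
  "scaled_trunc x k = (\<Sum>i=0..k. digit x i * 10 ^ (k - i))"

lemma scaled_trunc_0: "scaled_trunc x 0 = digit x 0"
  by (simp add: scaled_trunc_def)

lemma scaled_trunc_Suc: "scaled_trunc x (Suc k) = 10 * scaled_trunc x k + digit x (Suc k)"
  by (simp add: scaled_trunc_def sum_distrib_left Suc_diff_le mult_ac)

lemma of_int_scaled_trunc: "of_int (scaled_trunc x k) = 10 ^ k * trunc x k"
proof (induction k)
  case 0
  then show ?case by (simp add: scaled_trunc_0 trunc_def)
next
  case (Suc k)
  then show ?case by (simp add: scaled_trunc_Suc trunc_Suc distrib_left)
qed

lemma scaled_trunc_div: "scaled_trunc x (Suc k) div 10 = scaled_trunc x k"
  using digit_bounds[of "Suc k" x] by (simp add: scaled_trunc_Suc)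

lemma trunc_le_iff: "trunc x k \<le> trunc y k \<longleftrightarrow> scaled_trunc x k \<le> scaled_trunc y k"
proof -
  have "scaled_trunc x k \<le> scaled_trunc y k \<longleftrightarrow>
      (of_int (scaled_trunc x k) :: rat) \<le> of_int (scaled_trunc y k)"
    by simp
  then show ?thesis
    by (simp add: of_int_scaled_trunc del: of_int_le_iff)
qed

text \<open>The order on decimals only compares places \<open>k \<ge> 1\<close>. Place 0 follows
  from place 1, because dividing by 10 is monotone and drops the last digit.\<close>

lemma less_eq_decimal_iff: "x \<le> y \<longleftrightarrow> (\<forall>k. scaled_trunc x k \<le> scaled_trunc y k)"
proof
  assume "x \<le> y"
  then have "scaled_trunc x (Suc k) \<le> scaled_trunc y (Suc k)" for k
    by (simp add: less_eq_decimal_def trunc_le_iff)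
  then show "\<forall>k. scaled_trunc x k \<le> scaled_trunc y k"
    by (metis scaled_trunc_div zdiv_mono1 zero_less_numeral)
qed (simp add: less_eq_decimal_def trunc_le_iff)

text \<open>The hypothesis amounts to \<open>F (Suc k) = 10 * F k + F (Suc k) mod 10\<close>, the
  recurrence of \<open>scaled_trunc\<close> with residues mod 10 as digits.\<close>

lemma decimal_of_scaled_truncs:
  fixes F :: "nat \<Rightarrow> int"
  assumes "\<And>k. F (Suc k) div 10 = F k"
  obtains x where "\<And>k. scaled_trunc x k = F k"
proof -
  define d where "d k = (if k = 0 then F 0 else F k mod 10)" for k
  have "F k mod 10 \<le> 9" for k
    using pos_mod_bound[of 10 "F k"] by linarith
  then have digit: "digit (Decimal d) = d"
    by (intro Decimal_inverse) (simp add: d_def)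
  have d: "d 0 = F 0" "d (Suc k) = F (Suc k) mod 10" for k
    by (simp_all add: d_def)
  have "scaled_trunc (Decimal d) k = F k" for k
  proof (induction k)
    case 0
    then show ?case by (simp add: scaled_trunc_0 digit d)
  next
    case (Suc k)
    have "10 * F k + F (Suc k) mod 10 = F (Suc k)"
      by (metis assms mult_div_mod_eq)
    then show ?case
      using Suc by (simp add: scaled_trunc_Suc digit d)
  qed
  then show thesis by (rule that)
qed

text \<open>Some element exceeds \<open>Sup X - 1\<close>; being an integer and at most
  \<open>Sup X\<close>, it equals \<open>Sup X\<close>.\<close>

lemma Sup_int_in:
  fixes X :: "int set"
  assumes "X \<noteq> {}" "bdd_above X"
  shows "Sup X \<in> X"
proof -
  obtain z where z: "z \<in> X" "Sup X - 1 < z"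
    using less_cSupE[of "Sup X - 1" X] assms(1) by auto
  then have "z = Sup X"
    using cSup_upper[OF z(1) assms(2)] by linarith
  with z show ?thesis by simp
qed

text \<open>Since the supremum is attained, its image is the maximum of the image set.\<close>

lemma Sup_int_image_mono:
  fixes X :: "int set" and f :: "int \<Rightarrow> int"
  assumes "mono f" "X \<noteq> {}" "bdd_above X"
  shows "Sup (f ` X) = f (Sup X)"
proof (rule cSup_eq_maximum)
  show "f (Sup X) \<in> f ` X"
    using Sup_int_in[OF assms(2,3)] by (rule imageI)
  show "y \<le> f (Sup X)" if "y \<in> f ` X" for y
    using that cSup_upper[OF _ assms(3)] monoD[OF assms(1)] by blast
qed

lemma ex_isLub_decimal:
  fixes W :: "decimal set"
  assumes "W \<noteq> {}" "bdd_above W"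
  shows "\<exists>s. isLub UNIV W s"
proof -
  define X where "X k = (\<lambda>w. scaled_trunc w k) ` W" for k
  obtain m where "\<And>w. w \<in> W \<Longrightarrow> w \<le> m"
    using assms(2) by (auto simp: bdd_above_def)
  then have X: "X k \<noteq> {}" "bdd_above (X k)" for k
    using assms(1)
    by (auto simp: X_def less_eq_decimal_iff intro!: bdd_aboveI2[of _ _ "scaled_trunc m k"])
  have X_div: "X k = (\<lambda>n. n div 10) ` X (Suc k)" for k
    by (simp add: X_def image_image scaled_trunc_div)
  have "mono (\<lambda>n :: int. n div 10)"
    by (simp add: mono_def zdiv_mono1)
  \<comment> \<open>Different places may attain their maxima at different elements of
    \<open>W\<close>; this compatibility still makes the maxima the truncations of a single
    decimal.\<close>
  then have "Sup (X (Suc k)) div 10 = Sup (X k)" for k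
    unfolding X_div[of k] using Sup_int_image_mono X by metis
  then obtain s where s: "\<And>k. scaled_trunc s k = Sup (X k)"
    using decimal_of_scaled_truncs[of "\<lambda>k. Sup (X k)"] by metis
  have "w \<le> s" if "w \<in> W" for w
    unfolding less_eq_decimal_iff s using that X(2) by (auto simp: X_def intro: cSup_upper)
  moreover have "s \<le> b" if "\<And>w. w \<in> W \<Longrightarrow> w \<le> b" for b
    unfolding less_eq_decimal_iff s using that X(1)
    by (auto simp: X_def less_eq_decimal_iff intro!: cSup_least)
  ultimately have "isLub UNIV W s"
    by (auto simp: isLub_def leastP_def isUb_def setle_def setge_def)
  then show ?thesis ..
qed

text \<open>Each element of \<open>W\<close> is an upper bound of the set of lower bounds, so
  \<open>t\<close> lies below it. Thus \<open>t\<close> is itself a lower bound, and it dominates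
  all others.\<close>

lemma isGlb_if_isLub_lower_bounds:
  assumes "isLub UNIV {l. \<forall>w\<in>W. l \<le> w} t"
  shows "isGlb UNIV W t"
  using assms by (auto simp: isLub_def isGlb_def leastP_def greatestP_def isUb_def isLb_def
      setle_def setge_def)

theorem theorem2p5:
  shows "(\<forall>W :: decimal set. W \<noteq> {} \<and> bdd_above W \<longrightarrow> (\<exists>s. isLub UNIV W s)) \<and>
    (\<forall>W :: decimal set. W \<noteq> {} \<and> bdd_below W \<longrightarrow> (\<exists>t. isGlb UNIV W t))"
proof (intro conjI allI impI; elim conjE)
  fix W :: "decimal set"
  assume "W \<noteq> {}" "bdd_above W"
  then show "\<exists>s. isLub UNIV W s"
    by (rule ex_isLub_decimal)
next
  fix W :: "decimal set"
  assume "W \<noteq> {}" "bdd_below W"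
  \<comment> \<open>A lower bound of \<open>W\<close> witnesses nonemptiness; any element of
    \<open>W\<close> bounds the set from above.\<close>
  then have "{l. \<forall>w\<in>W. l \<le> w} \<noteq> {}" "bdd_above {l. \<forall>w\<in>W. l \<le> w}"
    by (auto simp: bdd_below_def bdd_above_def)
  then obtain t where "isLub UNIV {l. \<forall>w\<in>W. l \<le> w} t"
    using ex_isLub_decimal by metis
  then show "\<exists>t. isGlb UNIV W t"
    by (intro exI isGlb_if_isLub_lower_bounds)
qed

end
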